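(* Let $A$ be a Banach algebra and $X$ a Banach $A$-bimodule such that for every $x''\in X^{**}$ the mapping $a''\mapsto x''a''$ from $A^{**}$ into $X^{**}$ is weak$^*$-to-weak continuous. If $D:A\to X^*$ is a derivation, then $D''(A^{**})X^{**}\subseteq A^*$.
   Context: A derivation $D:A\to Y$ into a Banach $A$-bimodule $Y$ is a bounded linear map with $D(xy)=xD(y)+D(x)y$ for all $x,y\in A$. $D''$ denotes the second adjoint of $D$, here $D'':A^{**}\to X^{***}$. $X^*$ is the dual $A$-bimodule: $\langle x'a,x\rangle=\langle x',ax\rangle$, $\langle ax',x\rangle=\langle x',xa\rangle$. $A^{**}$ carries the first Arens product: $\langle a'a,b\rangle=\langle a',ab\rangle$, $\langle a''a',a\rangle=\langle a'',a'a\rangle$, $\langle a''b'',a'\rangle=\langle a'',b''a'\rangle$. $X^{**}$ is a Banach $A^{**}$-bimodule with $a''x''=w^*\text{-}\lim_\alpha\lim_\beta a_\alpha x_\beta$ and $x''a''=w^*\text{-}\lim_\beta\lim_\alpha x_\beta a_\alpha$ whenever $(a_\alpha)\subseteq A$, $(x_\beta)\subseteq X$ are bounded nets converging weak$^*$ to $a''$, $x''$. For $x'''\in X^{***}$, $x''\in X^{**}$, the element $x'''x''\in A^{***}$ is defined by $\langle x'''x'',a''\rangle=\langle x''',x''a''\rangle$ for $a''\in A^{**}$. $D''(A^{**})X^{**}$ is the set of products $D''(a'')x''$, and $A^*$ is regarded as a subspace of $A^{***}$ via the canonical embedding. The weak$^*$ topology on $A^{**}$ is $\sigma(A^{**},A^*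 )$ and the weak topology on $X^{**}$ is $\sigma(X^{**},X^{***})$. *)

theory Defs
  imports "HOL-Analysis.Analysis" "HOL-Library.Function_Algebras"
begin

text \<open>
  The scalar field is a type variable of class \<^class>\<open>real_normed_field\<close>; by the Gelfand--Mazur
  theorem its only instances are, up to isomorphism, the reals and the complex numbers, so both
  cases are covered at once. The type \<open>('a, 'b) blinfun\<close> is not used for dual spaces because it
  only knows real-linear maps.

  A normed space is a carrier set inside an additive group together with a scalar multiplication
  and a norm. In the dual space a functional is represented by the function that vanishes off the
  carrier of the space it acts on, so that equality of functionals is equality of functions.
\<close>

record ('k, 'v) nspace =
  pts :: "'v set"
  scl :: "'k \<Rightarrow> 'v \<Rightarrow> 'v"
  nrm :: "'v \<Rightarrow> real"

definition scalar_space :: "('k::real_normed_field, 'k) nspace" where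
  "scalar_space = \<lparr>pts = UNIV, scl = (*), nrm = norm\<rparr>"

definition type_space :: "('k \<Rightarrow> 'v \<Rightarrow> 'v) \<Rightarrow> ('k, 'v::real_normed_vector) nspace" where
  "type_space s = \<lparr>pts = UNIV, scl = s, nrm = norm\<rparr>"

definition bounded_linear_op ::
  "('k, 'v::ab_group_add) nspace \<Rightarrow> ('k, 'w::ab_group_add) nspace \<Rightarrow> ('v \<Rightarrow> 'w) \<Rightarrow> bool" where
  "bounded_linear_op V W T \<longleftrightarrow>
     (\<forall>x\<in>pts V. T x \<in> pts W) \<and>
     (\<forall>x\<in>pts V. \<forall>y\<in>pts V. T (x + y) = T x + T y) \<and>
     (\<forall>c. \<forall>x\<in>pts V. T (scl V c x) = scl W c (T x)) \<and>
     (\<exists>K. \<forall>x\<in>pts V. nrm W (T x) \<le> K * nrm V x)"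

text \<open>The norm is the operator norm, written as in the definition of \<^const>\<open>onorm\<close>.\<close>

definition dual_space ::
  "('k::real_normed_field, 'v::ab_group_add) nspace \<Rightarrow> ('k, 'v \<Rightarrow> 'k) nspace" where
  "dual_space V =
     \<lparr>pts = {f. bounded_linear_op V scalar_space f \<and> (\<forall>x. x \<notin> pts V \<longrightarrow> f x = 0)},
      scl = (\<lambda>c f x. c * f x),
      nrm = (\<lambda>f. SUP x\<in>pts V. norm (f x) / nrm V x)\<rparr>"

definition canonical ::
  "('k::real_normed_field, 'v::ab_group_add) nspace \<Rightarrow> 'v \<Rightarrow> ('v \<Rightarrow> 'k) \<Rightarrow> 'k" where
  "canonical V v = (\<lambda>f. if f \<in> pts (dual_space V) then f v else 0)"

text \<open>The adjoint of \<open>T\<close>, a map from \<open>V\<close> into a space on which \<open>f\<close> is a functional.\<close>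

definition adj_op :: "('k::zero, 'v) nspace \<Rightarrow> ('v \<Rightarrow> 'w) \<Rightarrow> ('w \<Rightarrow> 'k) \<Rightarrow> ('v \<Rightarrow> 'k)" where
  "adj_op V T f = (\<lambda>v. if v \<in> pts V then f (T v) else 0)"

text \<open>
  Arens' adjoint of a bilinear map \<open>m : U \<times> V \<rightarrow> W\<close> is the map \<open>W\<^sup>* \<times> U \<rightarrow> V\<^sup>*\<close> with
  \<open>\<langle>m\<^sup>*(f, u), v\<rangle> = \<langle>f, m(u, v)\<rangle>\<close>; iterating it three times gives the extension
  \<open>U\<^sup>*\<^sup>* \<times> V\<^sup>*\<^sup>* \<rightarrow> W\<^sup>*\<^sup>*\<close> of \<open>m\<close>.
\<close>

definition arens_adj ::
  "('k::zero, 'v) nspace \<Rightarrow> ('u \<Rightarrow> 'v \<Rightarrow> 'w) \<Rightarrow> ('w \<Rightarrow> 'k) \<Rightarrow> 'u \<Rightarrow> ('v \<Rightarrow> 'k)" where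
  "arens_adj V m f u = adj_op V (m u) f"

definition arens_ext ::
  "('k::real_normed_field, 'u::ab_group_add) nspace \<Rightarrow> ('k, 'v::ab_group_add) nspace \<Rightarrow>
   ('k, 'w::ab_group_add) nspace \<Rightarrow> ('u \<Rightarrow> 'v \<Rightarrow> 'w) \<Rightarrow>
   (('u \<Rightarrow> 'k) \<Rightarrow> 'k) \<Rightarrow> (('v \<Rightarrow> 'k) \<Rightarrow> 'k) \<Rightarrow> (('w \<Rightarrow> 'k) \<Rightarrow> 'k)" where
  "arens_ext U V W m = arens_adj (dual_space W) (arens_adj U (arens_adj V m))"

definition initial_topology :: "'v set \<Rightarrow> ('v \<Rightarrow> 'k::topological_space) set \<Rightarrow> 'v topology" where
  "initial_topology S F = topology_generated_by {{v \<in> S. f v \<in> B} | f B. f \<in> F \<and> open B}"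

definition weak_topology ::
  "('k::real_normed_field, 'v::ab_group_add) nspace \<Rightarrow> 'v topology" where
  "weak_topology V = initial_topology (pts V) (pts (dual_space V))"

text \<open>The topology \<open>\<sigma>(V\<^sup>*, V)\<close> on the dual of \<open>V\<close>.\<close>

definition weak_star_topology ::
  "('k::real_normed_field, 'v::ab_group_add) nspace \<Rightarrow> ('v \<Rightarrow> 'k) topology" where
  "weak_star_topology V =
     initial_topology (pts (dual_space V)) (canonical V ` pts V)"

text \<open>
  Completeness of the norms and submultiplicativity of the norm of the algebra come from the type
  classes; algebras need not be unital.
\<close>

locale banach_space_over =
  vector_space scale for scale :: "'k::real_normed_field \<Rightarrow> 'v::banach \<Rightarrow> 'v" +
  assumes scale_of_real: "scale (of_real t) v = t *\<^sub>R v"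
    and norm_scale: "norm (scale c v) = norm c * norm v"

locale banach_algebra_over =
  banach_space_over sA
  for sA :: "'k::real_normed_field \<Rightarrow> 'a::{real_normed_algebra,banach} \<Rightarrow> 'a" +
  assumes scale_mult_left: "sA c a * b = sA c (a * b)"
    and scale_mult_right: "a * sA c b = sA c (a * b)"

locale banach_bimodule =
  A: banach_algebra_over sA + X: banach_space_over sX
  for sA :: "'k::real_normed_field \<Rightarrow> 'a::{real_normed_algebra,banach} \<Rightarrow> 'a"
    and sX :: "'k \<Rightarrow> 'x::banach \<Rightarrow> 'x" +
  fixes lact :: "'a \<Rightarrow> 'x \<Rightarrow> 'x" and ract :: "'x \<Rightarrow> 'a \<Rightarrow> 'x"
  assumes lact_add_left: "lact (a + b) x = lact a x + lact b x"
    and lact_add_right: "lact a (x + y) = lact a x + lact a y"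
    and lact_scale_left: "lact (sA c a) x = sX c (lact a x)"
    and lact_scale_right: "lact a (sX c x) = sX c (lact a x)"
    and lact_bounded: "\<exists>K. \<forall>a x. norm (lact a x) \<le> K * norm a * norm x"
    and ract_add_left: "ract (x + y) a = ract x a + ract y a"
    and ract_add_right: "ract x (a + b) = ract x a + ract x b"
    and ract_scale_left: "ract (sX c x) a = sX c (ract x a)"
    and ract_scale_right: "ract x (sA c a) = sX c (ract x a)"
    and ract_bounded: "\<exists>K. \<forall>x a. norm (ract x a) \<le> K * norm x * norm a"
    and lact_mult: "lact (a * b) x = lact a (lact b x)"
    and ract_mult: "ract x (a * b) = ract (ract x a) b"
    and lact_ract: "ract (lact a x) b = lact a (ract x b)"

text \<open>
  The dual bimodule: \<open>\<langle>f a, x\<rangle> = \<langle>f, a x\<rangle>\<close> and \<open>\<langle>a f, x\<rangle> = \<langle>f, x a\<rangle>\<close>.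
\<close>

definition dual_ract ::
  "('a \<Rightarrow> 'x \<Rightarrow> 'x) \<Rightarrow> ('x \<Rightarrow> 'k) \<Rightarrow> 'a \<Rightarrow> ('x \<Rightarrow> 'k)" where
  "dual_ract lact f a = (\<lambda>x. f (lact a x))"

definition dual_lact ::
  "('x \<Rightarrow> 'a \<Rightarrow> 'x) \<Rightarrow> 'a \<Rightarrow> ('x \<Rightarrow> 'k) \<Rightarrow> ('x \<Rightarrow> 'k)" where
  "dual_lact ract a f = (\<lambda>x. f (ract x a))"

definition derivation_into_dual ::
  "('k::real_normed_field \<Rightarrow> 'a \<Rightarrow> 'a) \<Rightarrow> ('k \<Rightarrow> 'x \<Rightarrow> 'x) \<Rightarrow>
   ('a \<Rightarrow> 'x \<Rightarrow> 'x) \<Rightarrow> ('x \<Rightarrow> 'a \<Rightarrow> 'x) \<Rightarrow>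
   ('a::{real_normed_algebra,banach} \<Rightarrow> ('x::banach \<Rightarrow> 'k)) \<Rightarrow> bool" where
  "derivation_into_dual sA sX lact ract D \<longleftrightarrow>
     bounded_linear_op (type_space sA) (dual_space (type_space sX)) D \<and>
     (\<forall>a b. D (a * b) = dual_lact ract a (D b) + dual_ract lact (D a) b)"

text \<open>The second adjoint \<open>V\<^sup>*\<^sup>* \<rightarrow> W\<^sup>*\<^sup>*\<close> of an operator \<open>T : V \<rightarrow> W\<close>.\<close>

definition second_adj ::
  "('k::real_normed_field, 'v::ab_group_add) nspace \<Rightarrow> ('k, 'w::ab_group_add) nspace \<Rightarrow>
   ('v \<Rightarrow> 'w) \<Rightarrow> (('v \<Rightarrow> 'k) \<Rightarrow> 'k) \<Rightarrow> (('w \<Rightarrow> 'k) \<Rightarrow> 'k)" where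
  "second_adj V W T = adj_op (dual_space W) (adj_op V T)"

definition bidual_ract ::
  "('k::real_normed_field \<Rightarrow> 'a \<Rightarrow> 'a) \<Rightarrow> ('k \<Rightarrow> 'x \<Rightarrow> 'x) \<Rightarrow> ('x \<Rightarrow> 'a \<Rightarrow> 'x) \<Rightarrow>
   (('x::banach \<Rightarrow> 'k) \<Rightarrow> 'k) \<Rightarrow> (('a::banach \<Rightarrow> 'k) \<Rightarrow> 'k) \<Rightarrow> (('x \<Rightarrow> 'k) \<Rightarrow> 'k)" where
  "bidual_ract sA sX ract =
     arens_ext (type_space sX) (type_space sA) (type_space sX) ract"

text \<open>The functional \<open>x''' x''\<close> on \<open>A\<^sup>*\<^sup>*\<close>, given by \<open>\<langle>x''' x'', a''\<rangle> = \<langle>x''', x'' a''\<rangle>\<close>.\<close>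

definition tridual_prod ::
  "('k::real_normed_field \<Rightarrow> 'a \<Rightarrow> 'a) \<Rightarrow> ('k \<Rightarrow> 'x \<Rightarrow> 'x) \<Rightarrow> ('x \<Rightarrow> 'a \<Rightarrow> 'x) \<Rightarrow>
   ((('x::banach \<Rightarrow> 'k) \<Rightarrow> 'k) \<Rightarrow> 'k) \<Rightarrow> (('x \<Rightarrow> 'k) \<Rightarrow> 'k) \<Rightarrow> ((('a::banach \<Rightarrow> 'k) \<Rightarrow> 'k) \<Rightarrow> 'k)" where
  "tridual_prod sA sX ract =
     arens_adj (dual_space (dual_space (type_space sA))) (bidual_ract sA sX ract)"

text \<open>
  The remaining facts confirm that \<open>X\<^sup>*\<^sup>*\<close> is closed under the right action and that this action is
  the iterated weak-star limit \<open>x'' a'' = lim\<^sub>j lim\<^sub>i x\<^sub>j a\<^sub>i\<close>. Arbitrary filters take the place of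
  directed index sets, and boundedness of the nets is not needed.
\<close>

lemma mem_dual_space:
  "f \<in> pts (dual_space V) \<longleftrightarrow>
     (\<forall>x\<in>pts V. \<forall>y\<in>pts V. f (x + y) = f x + f y) \<and>
     (\<forall>c. \<forall>x\<in>pts V. f (scl V c x) = c * f x) \<and>
     (\<exists>K. \<forall>x\<in>pts V. norm (f x) \<le> K * nrm V x) \<and>
     (\<forall>x. x \<notin> pts V \<longrightarrow> f x = 0)"
  by (auto simp: dual_space_def bounded_linear_op_def scalar_space_def)

lemma type_space_simps [simp]:
  "pts (type_space s) = UNIV" "scl (type_space s) = s" "nrm (type_space s) = norm"
  by (simp_all add: type_space_def)

lemma scl_dual_space [simp]: "scl (dual_space V) = (\<lambda>c f x. c * f x)"
  by (simp add: dual_space_def)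

lemma dual_norm_bound:
  assumes f: "f \<in> pts (dual_space V)" and x: "x \<in> pts V"
    and nn: "\<And>y. y \<in> pts V \<Longrightarrow> nrm V y \<ge> 0"
  shows "norm (f x) \<le> nrm (dual_space V) f * nrm V x"
proof -
  from f obtain K where K: "\<And>y. y \<in> pts V \<Longrightarrow> norm (f y) \<le> K * nrm V y"
    unfolding mem_dual_space by blast
  have "norm (f y) / nrm V y \<le> \<bar>K\<bar>" if "y \<in> pts V" for y
  proof (cases "nrm V y = 0")
    case False
    with nn[OF that] have "nrm V y > 0" by simp
    moreover have "K * nrm V y \<le> \<bar>K\<bar> * nrm V y" using nn[OF that] by (rule mult_right_mono[OF abs_ge_self])
    ultimately show ?thesis
      using order_trans[OF K[OF that], of "\<bar>K\<bar> * nrm V y"] by (simp add: pos_divide_le_eq)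
  qed simp
  then have bdd: "bdd_above ((\<lambda>y. norm (f y) / nrm V y) ` pts V)" by (intro bdd_aboveI2)
  have le: "norm (f x) / nrm V x \<le> nrm (dual_space V) f"
    using cSUP_upper[OF x bdd] by (simp add: dual_space_def)
  show ?thesis
  proof (cases "nrm V x = 0")
    case True
    with K[OF x] show ?thesis by simp
  next
    case False
    with nn[OF x] have "nrm V x > 0" by simp
    with le show ?thesis by (simp add: pos_divide_le_eq)
  qed
qed

lemma dual_norm_le:
  assumes ne: "pts V \<noteq> {}" and C: "C \<ge> 0"
    and nn: "\<And>y. y \<in> pts V \<Longrightarrow> nrm V y \<ge> 0"
    and b: "\<And>y. y \<in> pts V \<Longrightarrow> norm (f y) \<le> C * nrm V y"
  shows "nrm (dual_space V) f \<le> C"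
proof -
  have "norm (f y) / nrm V y \<le> C" if "y \<in> pts V" for y
  proof (cases "nrm V y = 0")
    case False
    with nn[OF that] have "nrm V y > 0" by simp
    with b[OF that] show ?thesis by (simp add: pos_divide_le_eq)
  qed (simp add: C)
  then have "(SUP x\<in>pts V. norm (f x) / nrm V x) \<le> C" by (intro cSUP_least ne)
  then show ?thesis by (simp add: dual_space_def)
qed

lemma dual_norm_nonneg:
  fixes s :: "'k::real_normed_field \<Rightarrow> 'v::real_normed_vector \<Rightarrow> 'v"
  assumes f: "f \<in> pts (dual_space (type_space s))"
  shows "nrm (dual_space (type_space s)) f \<ge> 0"
proof (cases "\<exists>x::'v. x \<noteq> 0")
  case True
  then obtain x :: 'v where "x \<noteq> 0" by blast
  moreover have "0 \<le> nrm (dual_space (type_space s)) f * norm x"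
    using order_trans[OF norm_ge_zero dual_norm_bound[OF f, of x]] by simp
  ultimately show ?thesis by (simp add: zero_le_mult_iff)
next
  case False
  then have "x = 0" for x :: 'v by blast
  then have "(\<lambda>x. norm (f x) / norm x) = (\<lambda>x. 0)" by (metis div_by_0 norm_zero)
  then have "(SUP x. norm (f x) / norm x) = 0" by (simp only: cSUP_const[OF UNIV_not_empty])
  then show ?thesis by (simp add: dual_space_def)
qed

lemma dual_space_add:
  assumes f: "f \<in> pts (dual_space V)" and g: "g \<in> pts (dual_space V)"
  shows "f + g \<in> pts (dual_space V)"
proof -
  from f obtain K where K: "\<And>x. x \<in> pts V \<Longrightarrow> norm (f x) \<le> K * nrm V x"
    unfolding mem_dual_space by blast
  from g obtain L where L: "\<And>x. x \<in> pts V \<Longrightarrow> norm (g x) \<le> L * nrm V x"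
    unfolding mem_dual_space by blast
  have "norm (f x + g x) \<le> (K + L) * nrm V x" if "x \<in> pts V" for x
    using norm_triangle_ineq[of "f x" "g x"] K[OF that] L[OF that] by (simp add: distrib_right)
  then have "\<exists>K. \<forall>x\<in>pts V. norm (f x + g x) \<le> K * nrm V x" by blast
  with f g show ?thesis by (simp add: mem_dual_space algebra_simps)
qed

lemma dual_space_scale:
  assumes f: "f \<in> pts (dual_space V)"
  shows "(\<lambda>x. c * f x) \<in> pts (dual_space V)"
proof -
  from f obtain K where K: "\<And>x. x \<in> pts V \<Longrightarrow> norm (f x) \<le> K * nrm V x"
    unfolding mem_dual_space by blast
  have "norm (c * f x) \<le> (norm c * K) * nrm V x" if "x \<in> pts V" for x
    using mult_left_mono[OF K[OF that] norm_ge_zero[of c]] by (simp add: norm_mult mult.assoc)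
  then have "\<exists>K. \<forall>x\<in>pts V. norm (c * f x) \<le> K * nrm V x" by blast
  with f show ?thesis by (simp add: mem_dual_space algebra_simps)
qed

lemma canonical_mem:
  fixes s :: "'k::real_normed_field \<Rightarrow> 'v::real_normed_vector \<Rightarrow> 'v"
  shows "canonical (type_space s) v \<in> pts (dual_space (dual_space (type_space s)))"
proof -
  have "norm (f v) \<le> norm v * nrm (dual_space (type_space s)) f"
    if "f \<in> pts (dual_space (type_space s))" for f
    using dual_norm_bound[OF that, of v] by (simp add: mult.commute)
  then show ?thesis
    by (subst mem_dual_space) (auto simp: canonical_def dual_space_add dual_space_scale)
qed

context banach_bimodule
begin

lemma ract_adj_mem:
  assumes f: "f \<in> pts (dual_space (type_space sX))"
  shows "arens_adj (type_space sA) ract f x \<in> pts (dual_space (type_space sA))"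
    and "\<exists>C\<ge>0. \<forall>f\<in>pts (dual_space (type_space sX)). \<forall>x.
           nrm (dual_space (type_space sA)) (arens_adj (type_space sA) ract f x)
             \<le> C * nrm (dual_space (type_space sX)) f * norm x"
proof -
  obtain K0 where K0: "norm (ract x a) \<le> K0 * norm x * norm a" for x a
    using ract_bounded by blast
  define K where "K = \<bar>K0\<bar>"
  have K: "norm (ract x a) \<le> K * norm x * norm a" for x a
    using K0[of x a] mult_right_mono[of K0 K "norm x * norm a"] order_trans[of "norm (ract x a)" "K0 * (norm x * norm a)" "K * (norm x * norm a)"]
    by (auto simp: K_def mult.assoc)
  have bound: "norm (g (ract x a)) \<le> (K * nrm (dual_space (type_space sX)) g * norm x) * norm a"
    if g: "g \<in> pts (dual_space (type_space sX))" for g x a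
  proof -
    have "norm (g (ract x a)) \<le> nrm (dual_space (type_space sX)) g * norm (ract x a)"
      using dual_norm_bound[OF g] by simp
    also have "\<dots> \<le> nrm (dual_space (type_space sX)) g * (K * norm x * norm a)"
      by (intro mult_left_mono K dual_norm_nonneg g)
    finally show ?thesis by (simp add: mult_ac)
  qed
  show "arens_adj (type_space sA) ract f x \<in> pts (dual_space (type_space sA))"
    using f bound[OF f, of x]
    by (auto simp: mem_dual_space arens_adj_def adj_op_def ract_add_right ract_scale_right)
  have "K \<ge> 0" by (simp add: K_def)
  then show "\<exists>C\<ge>0. \<forall>f\<in>pts (dual_space (type_space sX)). \<forall>x.
           nrm (dual_space (type_space sA)) (arens_adj (type_space sA) ract f x)
             \<le> C * nrm (dual_space (type_space sX)) f * norm x"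
    using bound
    by (intro exI[of _ K] conjI ballI allI dual_norm_le)
       (auto simp: arens_adj_def adj_op_def dual_norm_nonneg)
qed

lemma bidual_lact_dual_mem:
  assumes a: "a'' \<in> pts (dual_space (dual_space (type_space sA)))"
  shows "f \<in> pts (dual_space (type_space sX)) \<Longrightarrow>
           arens_adj (type_space sX) (arens_adj (type_space sA) ract) a'' f
             \<in> pts (dual_space (type_space sX))"
    and "\<exists>C\<ge>0. \<forall>f\<in>pts (dual_space (type_space sX)).
           nrm (dual_space (type_space sX))
               (arens_adj (type_space sX) (arens_adj (type_space sA) ract) a'' f)
             \<le> C * nrm (dual_space (type_space sX)) f"
proof -
  let ?A' = "dual_space (type_space sA)" and ?X' = "dual_space (type_space sX)"
  let ?m = "arens_adj (type_space sA) ract"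
  note mem = ract_adj_mem(1)
  have zero: "(\<lambda>x. 0) \<in> pts ?X'" by (auto simp: mem_dual_space intro: exI[of _ 0])
  obtain C where C: "C \<ge> 0" "\<And>f x. f \<in> pts ?X' \<Longrightarrow> nrm ?A' (?m f x) \<le> C * nrm ?X' f * norm x"
    using ract_adj_mem(2)[OF zero] by blast
  from a obtain L0 where L0: "\<And>g. g \<in> pts ?A' \<Longrightarrow> norm (a'' g) \<le> L0 * nrm ?A' g"
    unfolding mem_dual_space[of a''] by blast
  define L where "L = \<bar>L0\<bar>"
  have L: "norm (a'' g) \<le> L * nrm ?A' g" if "g \<in> pts ?A'" for g
    using L0[OF that] mult_right_mono[of L0 L "nrm ?A' g"] dual_norm_nonneg[OF that]
    by (fastforce simp: L_def)
  have bound: "norm (a'' (?m f x)) \<le> (L * C * nrm ?X' f) * norm x" if f: "f \<in> pts ?X'" for f x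
  proof -
    have "norm (a'' (?m f x)) \<le> L * nrm ?A' (?m f x)" by (rule L[OF mem[OF f]])
    also have "\<dots> \<le> L * (C * nrm ?X' f * norm x)"
      by (intro mult_left_mono C f) (simp add: L_def)
    finally show ?thesis by (simp add: mult_ac)
  qed
  have add: "a'' (g + h) = a'' g + a'' h" if "g \<in> pts ?A'" "h \<in> pts ?A'" for g h
    using a that by (simp add: mem_dual_space[of a''])
  have scale: "a'' (\<lambda>x. c * g x) = c * a'' g" if "g \<in> pts ?A'" for g c
    using a that by (simp add: mem_dual_space[of a''])
  show "arens_adj (type_space sX) ?m a'' f \<in> pts ?X'" if f: "f \<in> pts ?X'"
  proof -
    have "?m f (x + y) = ?m f x + ?m f y" for x y
      using f by (auto simp: arens_adj_def adj_op_def ract_add_left mem_dual_space fun_eq_iff)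
    moreover have "?m f (sX c x) = (\<lambda>a. c * ?m f x a)" for c x
      using f by (auto simp: arens_adj_def adj_op_def ract_scale_left mem_dual_space fun_eq_iff)
    moreover have "\<exists>K. \<forall>x. norm (a'' (?m f x)) \<le> K * norm x" using bound[OF f] by blast
    ultimately show ?thesis
      unfolding mem_dual_space[of "arens_adj _ ?m a'' f"]
      by (simp add: arens_adj_def[of _ ?m] adj_op_def[of "type_space sX"] add scale mem[OF f])
  qed
  show "\<exists>C\<ge>0. \<forall>f\<in>pts ?X'. nrm ?X' (arens_adj (type_space sX) ?m a'' f) \<le> C * nrm ?X' f"
  proof (intro exI[of _ "L * C"] conjI ballI dual_norm_le)
    show "0 \<le> L * C" using C by (simp add: L_def)
    show "0 \<le> L * C * nrm ?X' f" if "f \<in> pts ?X'" for f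
      using C dual_norm_nonneg[OF that] by (simp add: L_def)
  qed (auto simp: arens_adj_def[of _ ?m] adj_op_def[of "type_space sX"] bound)
qed

lemma bidual_ract_mem:
  assumes x: "x'' \<in> pts (dual_space (dual_space (type_space sX)))"
    and a: "a'' \<in> pts (dual_space (dual_space (type_space sA)))"
  shows "bidual_ract sA sX ract x'' a'' \<in> pts (dual_space (dual_space (type_space sX)))"
proof -
  let ?X' = "dual_space (type_space sX)"
  let ?n = "arens_adj (type_space sX) (arens_adj (type_space sA) ract) a''"
  note mem = bidual_lact_dual_mem(1)[OF a]
  obtain C where C: "C \<ge> 0" "\<And>f. f \<in> pts ?X' \<Longrightarrow> nrm ?X' (?n f) \<le> C * nrm ?X' f"
    using bidual_lact_dual_mem(2)[OF a] by blast
  from x obtain L0 where L0: "\<And>g. g \<in> pts ?X' \<Longrightarrow> norm (x'' g) \<le> L0 * nrm ?X' g"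
    unfolding mem_dual_space[of x''] by blast
  have "norm (x'' (?n f)) \<le> (\<bar>L0\<bar> * C) * nrm ?X' f" if f: "f \<in> pts ?X'" for f
  proof -
    have "norm (x'' (?n f)) \<le> L0 * nrm ?X' (?n f)" by (rule L0[OF mem[OF f]])
    also have "\<dots> \<le> \<bar>L0\<bar> * nrm ?X' (?n f)"
      by (intro mult_right_mono dual_norm_nonneg mem f) auto
    also have "\<dots> \<le> \<bar>L0\<bar> * (C * nrm ?X' f)" by (intro mult_left_mono C f) auto
    finally show ?thesis by (simp add: mult_ac)
  qed
  then have bdd: "\<exists>K. \<forall>f\<in>pts ?X'. norm (x'' (?n f)) \<le> K * nrm ?X' f" by blast
  have add_a: "a'' (g + h) = a'' g + a'' h"
    if "g \<in> pts (dual_space (type_space sA))" "h \<in> pts (dual_space (type_space sA))" for g h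
    using a that by (simp add: mem_dual_space[of a''])
  have scale_a: "a'' (\<lambda>x. c * g x) = c * a'' g" if "g \<in> pts (dual_space (type_space sA))" for g c
    using a that by (simp add: mem_dual_space[of a''])
  have n_add: "?n (f + g) = ?n f + ?n g" if "f \<in> pts ?X'" "g \<in> pts ?X'" for f g
  proof
    fix z
    have "arens_adj (type_space sA) ract (f + g) z
        = arens_adj (type_space sA) ract f z + arens_adj (type_space sA) ract g z"
      by (auto simp: arens_adj_def adj_op_def fun_eq_iff)
    then show "?n (f + g) z = (?n f + ?n g) z"
      using add_a[OF ract_adj_mem(1)[OF that(1)] ract_adj_mem(1)[OF that(2)]]
      by (simp add: arens_adj_def[of "type_space sX"] adj_op_def[of "type_space sX"])
  qed
  have n_scale: "?n (\<lambda>x. c * f x) = (\<lambda>x. c * ?n f x)" if "f \<in> pts ?X'" for f c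
  proof
    fix z
    have "arens_adj (type_space sA) ract (\<lambda>x. c * f x) z
        = (\<lambda>a. c * arens_adj (type_space sA) ract f z a)"
      by (auto simp: arens_adj_def adj_op_def fun_eq_iff)
    then show "?n (\<lambda>x. c * f x) z = c * ?n f z"
      using scale_a[OF ract_adj_mem(1)[OF that]]
      by (simp add: arens_adj_def[of "type_space sX"] adj_op_def[of "type_space sX"])
  qed
  have add: "x'' (f + g) = x'' f + x'' g" if "f \<in> pts ?X'" "g \<in> pts ?X'" for f g
    using x that by (simp add: mem_dual_space[of x''])
  have scale: "x'' (\<lambda>x. c * f x) = c * x'' f" if "f \<in> pts ?X'" for f c
    using x that by (simp add: mem_dual_space[of x''])
  have "bidual_ract sA sX ract x'' a'' = (\<lambda>f. if f \<in> pts ?X' then x'' (?n f) else 0)"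
    by (simp add: bidual_ract_def arens_ext_def arens_adj_def[of ?X'] adj_op_def[of ?X'])
  then show ?thesis
    unfolding mem_dual_space[of "bidual_ract sA sX ract x'' a''"]
    using bdd by (simp add: n_add n_scale dual_space_add dual_space_scale add scale mem)
qed

lemma bidual_ract_iterated_limit:
  fixes a :: "'i \<Rightarrow> 'a" and x :: "'j \<Rightarrow> 'x"
  assumes x'': "x'' \<in> pts (dual_space (dual_space (type_space sX)))"
    and a'': "a'' \<in> pts (dual_space (dual_space (type_space sA)))"
    and lim_a: "\<And>f. f \<in> pts (dual_space (type_space sA)) \<Longrightarrow> ((\<lambda>i. f (a i)) \<longlongrightarrow> a'' f) F"
    and lim_x: "\<And>f. f \<in> pts (dual_space (type_space sX)) \<Longrightarrow> ((\<lambda>j. f (x j)) \<longlongrightarrow> x'' f) G"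
  shows "\<exists>y. (\<forall>j. y j \<in> pts (dual_space (dual_space (type_space sX)))) \<and>
             (\<forall>j. \<forall>f\<in>pts (dual_space (type_space sX)). ((\<lambda>i. f (ract (x j) (a i))) \<longlongrightarrow> y j f) F) \<and>
             (\<forall>f\<in>pts (dual_space (type_space sX)).
                ((\<lambda>j. y j f) \<longlongrightarrow> bidual_ract sA sX ract x'' a'' f) G)"
proof -
  let ?X' = "dual_space (type_space sX)"
  let ?m = "arens_adj (type_space sA) ract"
  let ?n = "arens_adj (type_space sX) ?m a''"
  let ?y = "\<lambda>j. bidual_ract sA sX ract (canonical (type_space sX) (x j)) a''"
  have eval: "bidual_ract sA sX ract z a'' f = z (?n f)" if "f \<in> pts ?X'" for z f
    using that by (simp add: bidual_ract_def arens_ext_def arens_adj_def[of ?X'] adj_op_def[of ?X'])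
  have y: "?y j f = ?n f (x j)" if "f \<in> pts ?X'" for j f
    using that bidual_lact_dual_mem(1)[OF a''] by (simp add: eval canonical_def)
  have "?y j \<in> pts (dual_space ?X')" for j
    by (intro bidual_ract_mem canonical_mem a'')
  moreover have "((\<lambda>i. f (ract (x j) (a i))) \<longlongrightarrow> ?y j f) F" if f: "f \<in> pts ?X'" for j f
    using lim_a[OF ract_adj_mem(1)[OF f, of "x j"]]
    by (simp add: y[OF f] arens_adj_def adj_op_def)
  moreover have "((\<lambda>j. ?y j f) \<longlongrightarrow> bidual_ract sA sX ract x'' a'' f) G" if f: "f \<in> pts ?X'" for f
    using lim_x[OF bidual_lact_dual_mem(1)[OF a'' f]] by (simp only: y[OF f] eval[OF f, of x''])
  ultimately show ?thesis by (intro exI[of _ ?y]) blast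
qed

end

end

theory Submission
  imports Defs
begin

text \<open>
  Fix \<open>x'''\<close> in \<open>X\<^sup>*\<^sup>*\<^sup>*\<close> and \<open>x''\<close> in \<open>X\<^sup>*\<^sup>*\<close>. The functional \<open>x''' x''\<close> is the composition of
  \<open>a'' \<mapsto> x'' a''\<close>, which is weak-star-to-weak continuous by hypothesis, with \<open>x'''\<close>, which is weakly
  continuous by definition of the weak topology. So \<open>x''' x''\<close> is a weak-star continuous linear
  functional on \<open>A\<^sup>*\<^sup>*\<close>, and such a functional is evaluation at an element of \<open>A\<^sup>*\<close>
  (\<open>weak_star_continuous_imp_canonical\<close>). This applies to \<open>x''' = D''(a'')\<close> because the second
  adjoint of the bounded operator \<open>D\<close> takes its values in \<open>X\<^sup>*\<^sup>*\<^sup>*\<close> (\<open>second_adj_mem\<close>).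

  The classical fact about weak-star continuous functionals \<open>\<phi>\<close> is obtained as follows. A subbasic
  open set is defined by the value of one functional, so a neighbourhood of \<open>0\<close> contains every
  point that vanishes at some finitely many elements \<open>g\<^sub>1, \<dots>, g\<^sub>n\<close> of the predual
  (\<open>openin_initial_topology_finite\<close>). If the neighbourhood is the one where \<open>\<phi>\<close> has norm below \<open>1\<close>,
  then \<open>\<phi>\<close> is bounded on the subspace of these points, hence zero there; and a functional that
  vanishes on the common kernel of finitely many functionals is a linear combination of them
  (\<open>functional_in_span_of_finite\<close>).
\<close>

section \<open>Functionals vanishing on a finite intersection of kernels\<close>

definition linear_on ::
  "'v::ab_group_add set \<Rightarrow> ('k::field \<Rightarrow> 'v \<Rightarrow> 'v) \<Rightarrow> ('v \<Rightarrow> 'k) \<Rightarrow> bool" where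
  "linear_on S s f \<longleftrightarrow>
     (\<forall>x\<in>S. \<forall>y\<in>S. f (x + y) = f x + f y) \<and> (\<forall>c. \<forall>x\<in>S. f (s c x) = c * f x)"

definition subspace_of :: "'v::ab_group_add set \<Rightarrow> ('k::field \<Rightarrow> 'v \<Rightarrow> 'v) \<Rightarrow> bool" where
  "subspace_of S s \<longleftrightarrow>
     0 \<in> S \<and> (\<forall>x\<in>S. \<forall>y\<in>S. x + y \<in> S) \<and> (\<forall>c. \<forall>x\<in>S. s c x \<in> S)"

lemma linear_on_subset: "linear_on S s f \<Longrightarrow> T \<subseteq> S \<Longrightarrow> linear_on T s f"
  unfolding linear_on_def by blast

lemma linear_on_zero:
  assumes "linear_on S s f" "0 \<in> S"
  shows "f 0 = 0"
proof -
  have "f (0 + 0) = f 0 + f 0" using assms unfolding linear_on_def by blast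
  then show ?thesis by (metis add.right_neutral add_left_cancel)
qed

lemma subspace_of_kernel:
  assumes S: "subspace_of S s" and f: "linear_on S s f"
  shows "subspace_of {v \<in> S. f v = 0} s"
  using S f linear_on_zero[OF f] unfolding subspace_of_def linear_on_def by auto

text \<open>
  Induction on the number of functionals, for all subspaces at once: the induction hypothesis is
  used on the kernel of the new functional \<open>e j\<close>. If \<open>e j\<close> is nonzero at \<open>u\<close>, every \<open>v\<close> differs from
  an element of this kernel by a multiple of \<open>u\<close>, and the value at \<open>u\<close> fixes the new coefficient.
\<close>

lemma functional_in_span_of_finite:
  fixes s :: "'k::field \<Rightarrow> 'v::ab_group_add \<Rightarrow> 'v"
  assumes "finite I" and "subspace_of S s"
    and "linear_on S s \<phi>" and "\<And>i. i \<in> I \<Longrightarrow> linear_on S s (e i)"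
    and "\<And>v. v \<in> S \<Longrightarrow> (\<And>i. i \<in> I \<Longrightarrow> e i v = 0) \<Longrightarrow> \<phi> v = 0"
  shows "\<exists>c. \<forall>v\<in>S. \<phi> v = (\<Sum>i\<in>I. c i * e i v)"
  using assms
proof (induction I arbitrary: S rule: finite_induct)
  case empty
  then show ?case by simp
next
  case (insert j I)
  note S = \<open>subspace_of S s\<close> and \<phi> = \<open>linear_on S s \<phi>\<close>
  have ej: "linear_on S s (e j)" and ei: "\<And>i. i \<in> I \<Longrightarrow> linear_on S s (e i)"
    using insert.prems(3) by auto
  let ?N = "{v \<in> S. e j v = 0}"
  have "\<exists>c. \<forall>v\<in>?N. \<phi> v = (\<Sum>i\<in>I. c i * e i v)"
  proof (rule insert.IH)
    show "subspace_of ?N s" by (rule subspace_of_kernel[OF S ej])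
    show "linear_on ?N s \<phi>" by (rule linear_on_subset[OF \<phi>]) auto
    show "linear_on ?N s (e i)" if "i \<in> I" for i
      by (rule linear_on_subset[OF ei[OF that]]) auto
    show "\<phi> v = 0" if "v \<in> ?N" "\<And>i. i \<in> I \<Longrightarrow> e i v = 0" for v
      using insert.prems(4)[of v] that by auto
  qed
  then obtain c where c: "\<And>v. v \<in> ?N \<Longrightarrow> \<phi> v = (\<Sum>i\<in>I. c i * e i v)" by blast
  define \<psi> where "\<psi> v = \<phi> v - (\<Sum>i\<in>I. c i * e i v)" for v
  have \<psi>_add: "\<psi> (x + y) = \<psi> x + \<psi> y" if "x \<in> S" "y \<in> S" for x y
  proof -
    have "(\<Sum>i\<in>I. c i * e i (x + y)) = (\<Sum>i\<in>I. c i * e i x + c i * e i y)"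
      by (rule sum.cong) (use ei that in \<open>auto simp: linear_on_def distrib_left\<close>)
    then show ?thesis
      using \<phi> that by (simp add: \<psi>_def linear_on_def sum.distrib)
  qed
  have \<psi>_scale: "\<psi> (s d x) = d * \<psi> x" if "x \<in> S" for d x
  proof -
    have "(\<Sum>i\<in>I. c i * e i (s d x)) = (\<Sum>i\<in>I. d * (c i * e i x))"
      by (rule sum.cong) (use ei that in \<open>auto simp: linear_on_def\<close>)
    then show ?thesis
      using \<phi> that by (simp add: \<psi>_def linear_on_def sum_distrib_left right_diff_distrib)
  qed
  have \<psi>_ker: "\<psi> v = 0" if "v \<in> S" "e j v = 0" for v
    using c[of v] that by (simp add: \<psi>_def)
  have "\<exists>d. \<forall>v\<in>S. \<psi> v = d * e j v"
  proof (cases "\<forall>v\<in>S. e j v = 0")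
    case True
    then show ?thesis using \<psi>_ker by auto
  next
    case False
    then obtain u where u: "u \<in> S" "e j u \<noteq> 0" by blast
    have "\<psi> v = \<psi> u / e j u * e j v" if v: "v \<in> S" for v
    proof -
      define r where "r = - (e j v / e j u)"
      have ru: "s r u \<in> S" and w: "v + s r u \<in> S"
        using S u v by (auto simp: subspace_of_def)
      have "e j (v + s r u) = e j v + r * e j u"
        using ej u v ru by (simp add: linear_on_def)
      also have "\<dots> = 0" using u by (simp add: r_def)
      finally have "\<psi> (v + s r u) = 0" by (rule \<psi>_ker[OF w])
      then have "\<psi> v + r * \<psi> u = 0" using \<psi>_add[OF v ru] \<psi>_scale[OF u(1)] by simp
      then show ?thesis by (simp add: r_def)
    qed
    then show ?thesis by blast
  qed
  then obtain d where d: "\<And>v. v \<in> S \<Longrightarrow> \<psi> v = d * e j v" by blast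
  have "\<phi> v = (\<Sum>i\<in>insert j I. (c(j := d)) i * e i v)" if "v \<in> S" for v
  proof -
    have "(\<Sum>i\<in>I. (c(j := d)) i * e i v) = (\<Sum>i\<in>I. c i * e i v)"
      by (rule sum.cong) (use insert.hyps in auto)
    moreover have "\<phi> v = d * e j v + (\<Sum>i\<in>I. c i * e i v)"
      using d[OF that] by (simp add: \<psi>_def algebra_simps)
    ultimately show ?thesis using insert.hyps by simp
  qed
  then show ?case by blast
qed

section \<open>Weak-star continuous functionals\<close>

text \<open>
  Subbasic open sets depend on the value of a single functional, and this form of dependence on
  finitely many functionals survives finite intersections and arbitrary unions.
\<close>

lemma openin_initial_topology_finite:
  assumes "openin (initial_topology S F) U" and "u \<in> U"
  shows "\<exists>G. finite G \<and> G \<subseteq> F \<and> (\<forall>v\<in>S. (\<forall>f\<in>G. f v = f u) \<longrightarrow> v \<in> U)"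
proof -
  have "generate_topology_on {{v \<in> S. f v \<in> B} | f B. f \<in> F \<and> open B} U"
    using assms(1) by (simp add: initial_topology_def openin_topology_generated_by_iff)
  then show ?thesis using assms(2)
  proof (induction rule: generate_topology_on.induct)
    case Empty
    then show ?case by simp
  next
    case (Int U V)
    then obtain G H where
      "finite G" "G \<subseteq> F" "\<forall>v\<in>S. (\<forall>f\<in>G. f v = f u) \<longrightarrow> v \<in> U"
      "finite H" "H \<subseteq> F" "\<forall>v\<in>S. (\<forall>f\<in>H. f v = f u) \<longrightarrow> v \<in> V"
      by auto
    then show ?case by (intro exI[of _ "G \<union> H"]) auto
  next
    case (UN K)
    then obtain V where V: "V \<in> K" "u \<in> V" by blast
    from UN.IH[OF V] obtain G where
      "finite G" "G \<subseteq> F" "\<forall>v\<in>S. (\<forall>f\<in>G. f v = f u) \<longrightarrow> v \<in> V"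
      by auto
    with \<open>V \<in> K\<close> show ?case by (intro exI[of _ G]) auto
  next
    case (Basis V)
    then obtain f B where "f \<in> F" "V = {v \<in> S. f v \<in> B}" by blast
    with Basis show ?case by (intro exI[of _ "{f}"]) auto
  qed
qed

lemma topspace_initial_topology:
  assumes "F \<noteq> {}"
  shows "topspace (initial_topology S F) = S"
proof -
  obtain f where f: "f \<in> F" using assms by blast
  have "S \<in> {{v \<in> S. f v \<in> B} | f B. f \<in> F \<and> open B}"
    using f by (intro CollectI exI[of _ f] exI[of _ UNIV]) auto
  then show ?thesis by (auto simp: initial_topology_def)
qed

lemma continuous_map_initial_topology:
  assumes f: "f \<in> F"
  shows "continuous_map (initial_topology S F) euclidean f"
proof -
  have top: "topspace (initial_topology S F) = S"
    using f by (intro topspace_initial_topology) auto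
  have "openin (initial_topology S F) {v \<in> S. f v \<in> B}" if "open B" for B
    unfolding initial_topology_def
    by (rule topology_generated_by_Basis) (use f that in blast)
  then show ?thesis by (simp add: continuous_map_def top)
qed

lemma linear_on_dual:
  "f \<in> pts (dual_space V) \<Longrightarrow> linear_on (pts V) (scl V) f"
  by (simp add: mem_dual_space linear_on_def)

lemma zero_in_dual_space: "0 \<in> pts (dual_space V)"
  by (auto simp: mem_dual_space intro: exI[of _ 0])

lemma subspace_of_dual: "subspace_of (pts (dual_space V)) (scl (dual_space V))"
  by (simp add: subspace_of_def dual_space_add dual_space_scale zero_in_dual_space)

lemma linear_combination_mem_and_eval:
  assumes V: "subspace_of (pts V) (scl V)" and "finite G" and "G \<subseteq> pts V"
  shows "(\<Sum>g\<in>G. scl V (c g) g) \<in> pts V \<and>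
         (\<forall>f\<in>pts (dual_space V). f (\<Sum>g\<in>G. scl V (c g) g) = (\<Sum>g\<in>G. c g * f g))"
  using assms(2,3)
proof (induction rule: finite_induct)
  case empty
  then show ?case using V linear_on_zero[OF linear_on_dual] by (auto simp: subspace_of_def)
next
  case (insert g G)
  have "scl V (c g) g \<in> pts V" using V insert.prems by (auto simp: subspace_of_def)
  then show ?case
    using V insert by (auto simp: subspace_of_def mem_dual_space)
qed

lemma weak_star_continuous_imp_canonical:
  fixes V :: "('k::real_normed_field, 'v::ab_group_add) nspace"
  assumes V: "subspace_of (pts V) (scl V)"
    and lin: "linear_on (pts (dual_space V)) (scl (dual_space V)) \<phi>"
    and cont: "continuous_map (weak_star_topology V) euclidean \<phi>"
  shows "\<exists>v\<in>pts V. \<forall>f\<in>pts (dual_space V). \<phi> f = canonical V v f"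
proof -
  let ?V' = "pts (dual_space V)"
  have top: "topspace (weak_star_topology V) = ?V'"
    unfolding weak_star_topology_def
    by (rule topspace_initial_topology) (use V in \<open>auto simp: subspace_of_def\<close>)
  have \<phi>0: "\<phi> 0 = 0" by (rule linear_on_zero[OF lin zero_in_dual_space])
  define U where "U = {f \<in> ?V'. \<phi> f \<in> ball 0 1}"
  have "openin (weak_star_topology V) U"
    using openin_continuous_map_preimage[OF cont, of "ball 0 1"]
    by (simp only: U_def top open_ball open_openin[symmetric])
  moreover have "0 \<in> U" by (simp add: U_def \<phi>0 zero_in_dual_space)
  ultimately have "\<exists>F. finite F \<and> F \<subseteq> canonical V ` pts V \<and>
      (\<forall>f\<in>?V'. (\<forall>e\<in>F. e f = e 0) \<longrightarrow> f \<in> U)"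
    unfolding weak_star_topology_def by (rule openin_initial_topology_finite)
  then obtain F where F: "finite F" "F \<subseteq> canonical V ` pts V"
    "\<And>f. f \<in> ?V' \<Longrightarrow> \<forall>e\<in>F. e f = e 0 \<Longrightarrow> f \<in> U"
    by blast
  obtain G where G: "G \<subseteq> pts V" "finite G" "F = canonical V ` G"
    using finite_subset_image[OF F(1,2)] by blast
  have "\<exists>c. \<forall>f\<in>?V'. \<phi> f = (\<Sum>g\<in>G. c g * f g)"
  proof (rule functional_in_span_of_finite[OF G(2) subspace_of_dual lin])
    show "linear_on ?V' (scl (dual_space V)) (\<lambda>f. f g)" for g
      by (simp add: linear_on_def)
    show "\<phi> f = 0" if f: "f \<in> ?V'" and fG: "\<And>g. g \<in> G \<Longrightarrow> f g = 0" for f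
    proof (rule ccontr)
      assume nz: "\<phi> f \<noteq> 0"
      \<comment> \<open>The common kernel is closed under scaling, so \<open>\<phi>\<close> would take the value \<open>1\<close> on it.\<close>
      let ?h = "\<lambda>x. inverse (\<phi> f) * f x"
      have h: "?h \<in> ?V'" by (rule dual_space_scale[OF f])
      have "?h \<in> U"
        by (rule F(3)[OF h])
           (use h fG zero_in_dual_space[of V] in \<open>auto simp: G(3) canonical_def\<close>)
      then have "norm (\<phi> ?h) < 1" by (simp add: U_def)
      moreover have "\<phi> ?h = inverse (\<phi> f) * \<phi> f" using lin f by (simp add: linear_on_def)
      ultimately show False using nz by simp
    qed
  qed
  then obtain c where c: "\<And>f. f \<in> ?V' \<Longrightarrow> \<phi> f = (\<Sum>g\<in>G. c g * f g)" by blast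
  show ?thesis
    using linear_combination_mem_and_eval[OF V G(2,1), of c] c
    by (intro bexI[of _ "\<Sum>g\<in>G. scl V (c g) g"]) (auto simp: canonical_def)
qed

section \<open>Second adjoints of bounded operators\<close>

text \<open>
  Where the norm of \<open>V\<close> is zero throughout, the supremum is over quotients by zero, which are zero.
\<close>

lemma dual_norm_nonneg_general:
  assumes f: "f \<in> pts (dual_space V)" and ne: "pts V \<noteq> {}"
    and nn: "\<And>x. x \<in> pts V \<Longrightarrow> nrm V x \<ge> 0"
  shows "nrm (dual_space V) f \<ge> 0"
proof (cases "\<exists>x\<in>pts V. nrm V x \<noteq> 0")
  case True
  then obtain x where x: "x \<in> pts V" "nrm V x > 0" using nn by force
  have "0 \<le> nrm (dual_space V) f * nrm V x"
    using order_trans[OF norm_ge_zero dual_norm_bound[OF f x(1) nn]] .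
  then show ?thesis using x(2) by (simp add: zero_le_mult_iff)
next
  case False
  then have "(SUP x\<in>pts V. norm (f x) / nrm V x) = (SUP x\<in>pts V. 0)"
    by (intro SUP_cong) auto
  then show ?thesis using ne by (simp add: dual_space_def)
qed

lemma adj_op_mem:
  assumes T: "bounded_linear_op V W T" and V: "subspace_of (pts V) (scl V)"
    and nn: "\<And>w. w \<in> pts W \<Longrightarrow> nrm W w \<ge> 0"
    and g: "g \<in> pts (dual_space W)"
  shows "adj_op V T g \<in> pts (dual_space V)"
proof -
  obtain K where K: "\<And>x. x \<in> pts V \<Longrightarrow> nrm W (T x) \<le> K * nrm V x"
    using T unfolding bounded_linear_op_def by blast
  obtain L where L: "\<And>w. w \<in> pts W \<Longrightarrow> norm (g w) \<le> L * nrm W w"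
    using g unfolding mem_dual_space by blast
  have "norm (g (T x)) \<le> (\<bar>L\<bar> * K) * nrm V x" if x: "x \<in> pts V" for x
  proof -
    have Tx: "T x \<in> pts W" using T x unfolding bounded_linear_op_def by blast
    have "norm (g (T x)) \<le> L * nrm W (T x)" by (rule L[OF Tx])
    also have "\<dots> \<le> \<bar>L\<bar> * nrm W (T x)" by (intro mult_right_mono nn Tx) auto
    also have "\<dots> \<le> \<bar>L\<bar> * (K * nrm V x)" by (intro mult_left_mono K x) auto
    finally show ?thesis by (simp add: mult_ac)
  qed
  then have "\<exists>K. \<forall>x\<in>pts V. norm (g (T x)) \<le> K * nrm V x" by blast
  then show ?thesis
    using T V g by (simp add: mem_dual_space adj_op_def bounded_linear_op_def subspace_of_def)
qed

lemma adj_op_bounded_linear: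
  assumes T: "bounded_linear_op V W T" and V: "subspace_of (pts V) (scl V)"
    and W: "pts W \<noteq> {}"
    and nnV: "\<And>v. v \<in> pts V \<Longrightarrow> nrm V v \<ge> 0"
    and nnW: "\<And>w. w \<in> pts W \<Longrightarrow> nrm W w \<ge> 0"
  shows "bounded_linear_op (dual_space W) (dual_space V) (adj_op V T)"
proof -
  obtain K where K: "\<And>x. x \<in> pts V \<Longrightarrow> nrm W (T x) \<le> K * nrm V x"
    using T unfolding bounded_linear_op_def by blast
  have "nrm (dual_space V) (adj_op V T g) \<le> \<bar>K\<bar> * nrm (dual_space W) g"
    if g: "g \<in> pts (dual_space W)" for g
  proof (rule dual_norm_le)
    have g0: "nrm (dual_space W) g \<ge> 0" by (rule dual_norm_nonneg_general[OF g W nnW])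
    then show "\<bar>K\<bar> * nrm (dual_space W) g \<ge> 0" by simp
    show "pts V \<noteq> {}" using V by (auto simp: subspace_of_def)
    fix x assume x: "x \<in> pts V"
    then have Tx: "T x \<in> pts W" using T unfolding bounded_linear_op_def by blast
    have "norm (g (T x)) \<le> nrm (dual_space W) g * nrm W (T x)"
      by (rule dual_norm_bound[OF g Tx nnW])
    also have "\<dots> \<le> nrm (dual_space W) g * (K * nrm V x)" by (intro mult_left_mono K x g0)
    also have "\<dots> \<le> nrm (dual_space W) g * (\<bar>K\<bar> * nrm V x)"
      by (intro mult_left_mono mult_right_mono nnV x g0) auto
    finally show "norm (adj_op V T g x) \<le> \<bar>K\<bar> * nrm (dual_space W) g * nrm V x"
      using x by (simp add: adj_op_def mult_ac)
  qed (rule nnV)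
  then have "\<exists>K. \<forall>g\<in>pts (dual_space W).
      nrm (dual_space V) (adj_op V T g) \<le> K * nrm (dual_space W) g" by blast
  then show ?thesis
    using adj_op_mem[OF T V nnW]
    by (auto simp: bounded_linear_op_def adj_op_def fun_eq_iff)
qed

lemma second_adj_mem:
  assumes T: "bounded_linear_op V W T" and V: "subspace_of (pts V) (scl V)"
    and W: "pts W \<noteq> {}"
    and nnV: "\<And>v. v \<in> pts V \<Longrightarrow> nrm V v \<ge> 0"
    and nnW: "\<And>w. w \<in> pts W \<Longrightarrow> nrm W w \<ge> 0"
    and v: "v'' \<in> pts (dual_space (dual_space V))"
  shows "second_adj V W T v'' \<in> pts (dual_space (dual_space W))"
  unfolding second_adj_def
proof (rule adj_op_mem[OF adj_op_bounded_linear[OF T V W nnV nnW] subspace_of_dual _ v])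
  show "nrm (dual_space V) f \<ge> 0" if "f \<in> pts (dual_space V)" for f
    using dual_norm_nonneg_general[OF that _ nnV] V by (auto simp: subspace_of_def)
qed

section \<open>The functional \<open>x''' x''\<close>\<close>

context banach_bimodule
begin

text \<open>
  In \<open>\<langle>x'' a'', f\<rangle> = \<langle>x'', a'' f\<rangle>\<close> the element \<open>a'' f\<close> of \<open>X\<^sup>*\<close> is given by
  \<open>\<langle>a'' f, x\<rangle> = \<langle>a'', f x\<rangle>\<close>, so it is linear in \<open>a''\<close>.
\<close>

lemma bidual_ract_linear_right:
  assumes x: "x'' \<in> pts (dual_space (dual_space (type_space sX)))"
    and a: "a'' \<in> pts (dual_space (dual_space (type_space sA)))"
  shows "b'' \<in> pts (dual_space (dual_space (type_space sA))) \<Longrightarrow>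
           bidual_ract sA sX ract x'' (a'' + b'')
             = bidual_ract sA sX ract x'' a'' + bidual_ract sA sX ract x'' b''"
    and "bidual_ract sA sX ract x'' (\<lambda>f. c * a'' f) = (\<lambda>f. c * bidual_ract sA sX ract x'' a'' f)"
proof -
  let ?X' = "dual_space (type_space sX)"
  let ?n = "arens_adj (type_space sX) (arens_adj (type_space sA) ract)"
  have eval: "bidual_ract sA sX ract x'' d f = (if f \<in> pts ?X' then x'' (?n d f) else 0)" for d f
    by (simp add: bidual_ract_def arens_ext_def arens_adj_def[of ?X'] adj_op_def[of ?X'])
  have n_add: "?n (a'' + b'') f = ?n a'' f + ?n b'' f" for b'' f
    by (simp add: arens_adj_def[of "type_space sX"] adj_op_def[of "type_space sX"] fun_eq_iff)
  have n_scale: "?n (\<lambda>f. c * a'' f) f = (\<lambda>x. c * ?n a'' f x)" for f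
    by (simp add: arens_adj_def[of "type_space sX"] adj_op_def[of "type_space sX"] fun_eq_iff)
  note mem = bidual_lact_dual_mem(1)
  have x_lin: "linear_on (pts ?X') (scl ?X') x''" by (rule linear_on_dual[OF x])
  show "bidual_ract sA sX ract x'' (a'' + b'')
           = bidual_ract sA sX ract x'' a'' + bidual_ract sA sX ract x'' b''"
    if b: "b'' \<in> pts (dual_space (dual_space (type_space sA)))"
    using x_lin mem[OF a] mem[OF b] by (auto simp: eval n_add linear_on_def fun_eq_iff)
  show "bidual_ract sA sX ract x'' (\<lambda>f. c * a'' f) = (\<lambda>f. c * bidual_ract sA sX ract x'' a'' f)"
    using x_lin mem[OF a] by (auto simp: eval n_scale linear_on_def fun_eq_iff)
qed

text \<open>
  Every \<open>x'''\<close> is continuous for the weak topology of \<open>X\<^sup>*\<^sup>*\<close>, so composing it with the continuous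
  map \<open>a'' \<mapsto> x'' a''\<close> leaves a weak-star continuous functional.
\<close>

lemma tridual_prod_in_canonical_image:
  assumes x: "x'' \<in> pts (dual_space (dual_space (type_space sX)))"
    and h: "x''' \<in> pts (dual_space (dual_space (dual_space (type_space sX))))"
    and cont: "continuous_map (weak_star_topology (dual_space (type_space sA)))
                 (weak_topology (dual_space (dual_space (type_space sX))))
                 (\<lambda>a''. bidual_ract sA sX ract x'' a'')"
  shows "tridual_prod sA sX ract x''' x''
           \<in> canonical (dual_space (type_space sA)) ` pts (dual_space (type_space sA))"
proof -
  let ?A' = "dual_space (type_space sA)" and ?X'' = "dual_space (dual_space (type_space sX))"
  let ?\<phi> = "\<lambda>a''. x''' (bidual_ract sA sX ract x'' a'')"
  have h_lin: "linear_on (pts ?X'') (scl ?X'') x'''" by (rule linear_on_dual[OF h])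
  have "linear_on (pts (dual_space ?A')) (scl (dual_space ?A')) ?\<phi>"
    using h_lin bidual_ract_mem[OF x] bidual_ract_linear_right[OF x]
    by (simp add: linear_on_def)
  moreover have "continuous_map (weak_star_topology ?A') euclidean ?\<phi>"
  proof -
    have "continuous_map (weak_topology ?X'') euclidean x'''"
      unfolding weak_topology_def by (rule continuous_map_initial_topology[OF h])
    from continuous_map_compose[OF cont this] show ?thesis by (simp add: o_def)
  qed
  ultimately obtain f where f: "f \<in> pts ?A'"
    "\<And>a''. a'' \<in> pts (dual_space ?A') \<Longrightarrow> ?\<phi> a'' = canonical ?A' f a''"
    using weak_star_continuous_imp_canonical[OF subspace_of_dual] by blast
  have "tridual_prod sA sX ract x''' x'' = canonical ?A' f"
    using f(2) by (auto simp: tridual_prod_def arens_adj_def[of "dual_space ?A'"]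
        adj_op_def[of "dual_space ?A'"] canonical_def fun_eq_iff)
  then show ?thesis using f(1) by blast
qed

end

theorem mainTheorem3:
  fixes sA :: "'k::real_normed_field \<Rightarrow> 'a::{real_normed_algebra,banach} \<Rightarrow> 'a"
    and sX :: "'k \<Rightarrow> 'x::banach \<Rightarrow> 'x"
    and lact :: "'a \<Rightarrow> 'x \<Rightarrow> 'x"
    and ract :: "'x \<Rightarrow> 'a \<Rightarrow> 'x"
    and D :: "'a \<Rightarrow> ('x \<Rightarrow> 'k)"
  defines "A \<equiv> type_space sA" and "X \<equiv> type_space sX"
  assumes "banach_bimodule sA sX lact ract"
    and "\<forall>x'' \<in> pts (dual_space (dual_space X)).
           continuous_map (weak_star_topology (dual_space A))
             (weak_topology (dual_space (dual_space X)))
             (\<lambda>a''. bidual_ract sA sX ract x'' a'')"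
    and "derivation_into_dual sA sX lact ract D"
  shows "{tridual_prod sA sX ract (second_adj A (dual_space X) D a'') x'' | a'' x''.
            a'' \<in> pts (dual_space (dual_space A)) \<and> x'' \<in> pts (dual_space (dual_space X))}
         \<subseteq> canonical (dual_space A) ` pts (dual_space A)"
proof -
  interpret banach_bimodule sA sX lact ract by fact
  have D: "bounded_linear_op A (dual_space X) D"
    using assms(5) unfolding derivation_into_dual_def A_def X_def by blast
  have D'': "second_adj A (dual_space X) D a'' \<in> pts (dual_space (dual_space (dual_space X)))"
    if "a'' \<in> pts (dual_space (dual_space A))" for a''
  proof (rule second_adj_mem[OF D _ _ _ _ that])
    show "subspace_of (pts A) (scl A)" by (simp add: A_def subspace_of_def)
    show "pts (dual_space X) \<noteq> {}" using zero_in_dual_space by blast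
    show "nrm A v \<ge> 0" for v by (simp add: A_def)
    show "nrm (dual_space X) f \<ge> 0" if "f \<in> pts (dual_space X)" for f
      using that unfolding X_def by (rule dual_norm_nonneg)
  qed
  show ?thesis
    using D'' assms(4) tridual_prod_in_canonical_image unfolding A_def X_def by blast
qed

end
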